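(* Let $A$ be a non-negative irreducible square matrix of order $N$ and let $P_A$ be its row-normalization. Fix $\lambda\in(0,1)$ and let $X(\lambda)=(1-\lambda)(I_N-\lambda P_A)^{-1}$. Then, for any personalization vector $\mathbf{v}\in\mathbb{R}^{N\times 1}$ with $\|\mathbf{v}\|_1=1$, the recursive sequence $\{\mathbf{x}_k\}_{k\ge 0}\subset\mathbb{R}^{N\times 1}$ with $\mathbf{x}_0=\mathbf{v}$ defined by $$\mathbf{x}_k^T=\mathbf{x}_{k-1}^T X(\lambda)=\mathbf{v}^T X(\lambda)^k,\qquad k\ge 1,$$ converges to the left-hand Perron vector $\mathbf{c}\in\mathbb{R}^{N\times 1}$ of the matrix $P_A$.
   Context: Vectors are column matrices. A vector or matrix is non-negative (positive) if all its entries are $\ge 0$ ($>0$). $\mathbf{e}=(1,\dots,1)^T$ and $\|\mathbf{x}\|_1=\sum_i|x_i|$. A personalization vector is a positive probability vector: $\mathbf{v}>0$ and $\mathbf{v}^T\mathbf{e}=1$. A square matrix $A$ of order $N\ge 2$ is reducible if there is a permutation matrix $R$ such that $R^TAR=\begin{pmatrix}X&Y\\ \mathbf{0}&Z\end{pmatrix}$ with $X,Z$ square (of order at least 1); otherwise it is irreducible. A $1\times1$ matrix is called irreducible when its entry is nonzero. Row-normalization: for a non-negative matrix $A=(a_{ij})$ with no zero row, $P_A=(p_{ij})$ is given by $p_{ij}=a_{ij}/\sum_k a_{ik}$; it is row-stochastic. (A non-negative irreducible matrix, with irreducibility meaning that no permutation matrix $R$ brings it to the block upper-triangular form $R^TAR=\begin{pmatrix}X&Y\\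 \mathbf{0}&Z\end{pmatrix}$ with $X,Z$ square of order at least 1 when $N\ge 2$, and that the single entry is nonzero when $N=1$, has no zero row.) Left-hand Perron vector: for a non-negative irreducible matrix $M$, the unique vector $\mathbf{q}$ with $\mathbf{q}^TM=\rho(M)\mathbf{q}^T$, $\mathbf{q}>0$, $\mathbf{q}^T\mathbf{e}=1$, where $\rho(M)$ is the spectral radius. *)

theory Defs
  imports
    Complex_Main
    "Jordan_Normal_Form.Gauss_Jordan_Elimination"
    "Jordan_Normal_Form.Spectral_Radius"
begin

text \<open>Vectors of length \<open>N\<close> are column matrices, i.e. elements of \<open>carrier_mat N 1\<close>.\<close>

definition nonneg_mat :: "real mat \<Rightarrow> bool" where
  "nonneg_mat A \<longleftrightarrow> (\<forall>i < dim_row A. \<forall>j < dim_col A. 0 \<le> A $$ (i, j))"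

definition positive_mat :: "real mat \<Rightarrow> bool" where
  "positive_mat A \<longleftrightarrow> (\<forall>i < dim_row A. \<forall>j < dim_col A. 0 < A $$ (i, j))"

definition permutation_mat :: "nat \<Rightarrow> real mat \<Rightarrow> bool" where
  "permutation_mat N R \<longleftrightarrow>
     (\<exists>p. p permutes {..<N} \<and> R = mat N N (\<lambda>(i, j). if i = p j then 1 else 0))"

definition reducible_mat :: "real mat \<Rightarrow> bool" where
  "reducible_mat A \<longleftrightarrow>
     (\<exists>R X Y Z r s. permutation_mat (dim_row A) R \<and> 1 \<le> r \<and> 1 \<le> s \<and>
        X \<in> carrier_mat r r \<and> Y \<in> carrier_mat r s \<and> Z \<in> carrier_mat s s \<and>
        transpose_mat R * A * R = four_block_mat X Y (0\<^sub>m s r) Z)"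

text \<open>A matrix of order 1 is irreducible iff its entry is nonzero; there is no irreducible matrix
  of order 0.\<close>

definition irreducible_mat :: "real mat \<Rightarrow> bool" where
  "irreducible_mat A \<longleftrightarrow> square_mat A \<and>
     (dim_row A = 1 \<and> A $$ (0, 0) \<noteq> 0 \<or> 2 \<le> dim_row A \<and> \<not> reducible_mat A)"

definition row_normalization :: "real mat \<Rightarrow> real mat" where
  "row_normalization A =
     mat (dim_row A) (dim_col A) (\<lambda>(i, j). A $$ (i, j) / (\<Sum>k < dim_col A. A $$ (i, k)))"

definition personalization_vector :: "nat \<Rightarrow> real mat \<Rightarrow> bool" where
  "personalization_vector N v \<longleftrightarrow>
     v \<in> carrier_mat N 1 \<and> positive_mat v \<and> (\<Sum>i < N. v $$ (i, 0)) = 1"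

definition left_perron_vector :: "real mat \<Rightarrow> real mat \<Rightarrow> bool" where
  "left_perron_vector M q \<longleftrightarrow>
     q \<in> carrier_mat (dim_row M) 1 \<and>
     transpose_mat q * M = spectral_radius (map_mat complex_of_real M) \<cdot>\<^sub>m transpose_mat q \<and>
     positive_mat q \<and> (\<Sum>i < dim_row M. q $$ (i, 0)) = 1"

text \<open>The option \<open>mat_inverse\<close> is \<open>Some\<close> of the two-sided inverse exactly for invertible matrices;
  outside that case the value below is unspecified.\<close>

definition resolvent_mat :: "real mat \<Rightarrow> real \<Rightarrow> real mat" where
  "resolvent_mat P l = (1 - l) \<cdot>\<^sub>m the (mat_inverse (1\<^sub>m (dim_row P) - l \<cdot>\<^sub>m P))"

text \<open>Matrices carry no topology in the library: convergence is entrywise, with fixed dimensions.\<close>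

definition mat_tendsto :: "(nat \<Rightarrow> real mat) \<Rightarrow> real mat \<Rightarrow> bool" where
  "mat_tendsto x c \<longleftrightarrow>
     (\<forall>k. x k \<in> carrier_mat (dim_row c) (dim_col c)) \<and>
     (\<forall>i < dim_row c. \<forall>j < dim_col c. (\<lambda>k. x k $$ (i, j)) \<longlonglongrightarrow> c $$ (i, j))"

end

theory Submission
  imports Defs
begin

text \<open>Irreducibility of \<open>P\<close> makes the resolvent \<open>X\<close> an entrywise positive stochastic matrix, and a
  left fixed vector of \<open>P\<close> is one of \<open>X\<close>. A positive stochastic matrix is a strict \<open>\<ell>\<^sub>1\<close>-contraction
  on row vectors of sum \<open>0\<close>. Since \<open>x\<^sub>k - c\<close> is such a vector, it tends to \<open>0\<close>; the same
  contraction gives uniqueness of \<open>c\<close> and the normalisability needed for its existence.\<close>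

section \<open>Stochastic matrices and matrix products written as sums\<close>

definition stochastic_mat :: "nat \<Rightarrow> real mat \<Rightarrow> bool" where
  "stochastic_mat N P \<longleftrightarrow>
     P \<in> carrier_mat N N \<and> nonneg_mat P \<and> (\<forall>i < N. (\<Sum>j < N. P $$ (i, j)) = 1)"

lemma stochastic_matD:
  assumes "stochastic_mat N P"
  shows "P \<in> carrier_mat N N" "\<And>i j. i < N \<Longrightarrow> j < N \<Longrightarrow> 0 \<le> P $$ (i, j)"
    "\<And>i. i < N \<Longrightarrow> (\<Sum>j < N. P $$ (i, j)) = 1"
  using assms by (auto simp: stochastic_mat_def nonneg_mat_def)

lemma mult_mat_vec_index_sum:
  assumes "A \<in> carrier_mat m n" "z \<in> carrier_vec n" "i < m"
  shows "(A *\<^sub>v z) $ i = (\<Sum>j < n. A $$ (i, j) * z $ j)"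
  using assms by (auto simp: scalar_prod_def atLeast0LessThan)

lemma mult_mat_index_sum:
  assumes "A \<in> carrier_mat m n" "B \<in> carrier_mat n k" "i < m" "j < k"
  shows "(A * B) $$ (i, j) = (\<Sum>r < n. A $$ (i, r) * B $$ (r, j))"
  using assms by (auto simp: scalar_prod_def atLeast0LessThan)

lemma row_mult_index_sum:
  assumes "c \<in> carrier_mat N 1" "B \<in> carrier_mat N k" "j < k"
  shows "(transpose_mat c * B) $$ (0, j) = (\<Sum>i < N. c $$ (i, 0) * B $$ (i, j))"
  using assms by (subst mult_mat_index_sum[of _ 1 N]) auto

subsection \<open>Irreducibility\<close>

text \<open>Otherwise every entry from \<open>S\<close> to its complement vanishes, and an ordering
  that lists the complement first exhibits the zero lower-left block. In this form irreducibility
  reaches the positivity of the resolvent.\<close>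

lemma irreducible_mat_edge:
  fixes A :: "real mat"
  assumes A: "A \<in> carrier_mat N N" and irr: "irreducible_mat A"
    and S: "S \<subset> {..<N}" "S \<noteq> {}"
  shows "\<exists>i \<in> S. \<exists>j \<in> {..<N} - S. A $$ (i, j) \<noteq> 0"
proof (rule ccontr)
  assume "\<not> ?thesis"
  then have zero: "A $$ (i, j) = 0" if "i \<in> S" "j < N" "j \<notin> S" for i j
    using that by auto
  define C where "C = {..<N} - S"
  define r where "r = card C"
  define s where "s = card S"
  have fin: "finite S" "finite C" using S finite_subset[of S "{..<N}"] by (auto simp: C_def)
  have r: "1 \<le> r" using S fin unfolding r_def C_def
    by (metis One_nat_def Suc_le_eq card_gt_0_iff Diff_eq_empty_iff psubset_eq subset_antisym)
  have s: "1 \<le> s" using S fin unfolding s_def by (simp add: Suc_le_eq card_gt_0_iff)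
  have rs: "r + s = N"
    using card_Diff_subset[of S "{..<N}"] card_mono[of "{..<N}" S] S fin
    by (auto simp: r_def s_def C_def)
  obtain f where f: "bij_betw f {..<r} C"
    using finite_same_card_bij[of "{..<r}" C] fin r_def by auto
  obtain g where g: "bij_betw g {r..<N} S"
    using finite_same_card_bij[of "{r..<N}" S] fin rs s_def by auto
  \<comment> \<open>\<open>f\<close> lists the complement, \<open>g\<close> lists \<open>S\<close>;
    beyond \<open>N\<close> the map must be the identity for \<open>permutes\<close> to
    hold.\<close>
  define p where "p a = (if a < r then f a else if a < N then g a else a)" for a
  have pC: "bij_betw p {..<r} C"
    using f by (rule bij_betw_cong[THEN iffD1, rotated]) (auto simp: p_def)
  have pS: "bij_betw p {r..<N} S"
    using g by (rule bij_betw_cong[THEN iffD1, rotated]) (auto simp: p_def)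
  have "bij_betw p ({..<r} \<union> {r..<N}) (C \<union> S)"
    by (rule bij_betw_combine[OF pC pS]) (auto simp: C_def)
  moreover have "{..<r} \<union> {r..<N} = {..<N}" using rs by auto
  moreover have "C \<union> S = {..<N}" using S by (auto simp: C_def)
  ultimately have pbij: "bij_betw p {..<N} {..<N}" by simp
  have perm: "p permutes {..<N}"
    by (rule bij_imp_permutes[OF pbij]) (use rs in \<open>auto simp: p_def\<close>)
  have p_lt: "p a < N" if "a < N" for a
    using pbij that by (auto simp: bij_betw_def)
  define R where "R = mat N N (\<lambda>(i, j). if i = p j then (1::real) else 0)"
  have R: "R \<in> carrier_mat N N" by (simp add: R_def)
  \<comment> \<open>\<open>R\<close> has its ones at the positions \<open>(p j, j)\<close>, so
    conjugation by it relabels the indices through \<open>p\<close>.\<close>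
  have RAR: "(transpose_mat R * A * R) $$ (a, b) = A $$ (p a, p b)" if "a < N" "b < N" for a b
  proof -
    have RA: "(transpose_mat R * A) $$ (a, k) = A $$ (p a, k)" if k: "k < N" for k
    proof -
      have "(transpose_mat R * A) $$ (a, k) = (\<Sum>i < N. (if i = p a then 1 else 0) * A $$ (i, k))"
        using R A k \<open>a < N\<close> by (subst mult_mat_index_sum[of _ N N]) (auto simp: R_def)
      also have "\<dots> = (\<Sum>i < N. if i = p a then A $$ (i, k) else 0)"
        by (rule sum.cong) auto
      finally show ?thesis using p_lt[OF \<open>a < N\<close>] by simp
    qed
    have "(transpose_mat R * A * R) $$ (a, b) = (\<Sum>k < N. A $$ (p a, k) * (if k = p b then 1 else 0))"
      using R A that RA by (subst mult_mat_index_sum[of _ N N]) (auto simp: R_def)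
    also have "\<dots> = (\<Sum>k < N. if k = p b then A $$ (p a, k) else 0)"
      by (rule sum.cong) auto
    finally show ?thesis using p_lt[OF \<open>b < N\<close>] by simp
  qed
  define M where "M = transpose_mat R * A * R"
  have M: "M \<in> carrier_mat N N" using R A by (simp add: M_def)
  define X Y Z where "X = mat r r (\<lambda>(i, j). M $$ (i, j))"
    and "Y = mat r s (\<lambda>(i, j). M $$ (i, j + r))"
    and "Z = mat s s (\<lambda>(i, j). M $$ (i + r, j + r))"
  have "M = four_block_mat X Y (0\<^sub>m s r) Z"
  proof (rule eq_matI)
    fix i j assume "i < dim_row (four_block_mat X Y (0\<^sub>m s r) Z)"
      "j < dim_col (four_block_mat X Y (0\<^sub>m s r) Z)"
    then have ij: "i < N" "j < N" using rs by (auto simp: X_def Z_def)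
    have "M $$ (i, j) = 0" if "\<not> i < r" "j < r"
    proof -
      have "p i \<in> S" using pS that ij by (auto simp: bij_betw_def)
      moreover have "p j \<in> C" using pC that by (auto simp: bij_betw_def)
      ultimately show ?thesis using zero RAR[OF ij] by (auto simp: M_def C_def)
    qed
    then show "M $$ (i, j) = four_block_mat X Y (0\<^sub>m s r) Z $$ (i, j)"
      using ij rs by (auto simp: X_def Y_def Z_def)
  qed (use M rs in \<open>auto simp: X_def Z_def\<close>)
  moreover have "permutation_mat N R"
    unfolding permutation_mat_def R_def using perm by blast
  ultimately have "reducible_mat A"
    unfolding reducible_mat_def using A r s
    by (intro exI[of _ R] exI[of _ X] exI[of _ Y] exI[of _ Z] exI[of _ r] exI[of _ s])
       (auto simp: M_def X_def Y_def Z_def)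
  \<comment> \<open>Both blocks are non-empty, so the order is at least 2 and irreducibility forbids
    the block form just found.\<close>
  moreover have "N \<noteq> 1" using r s rs by auto
  ultimately show False using irr A by (auto simp: irreducible_mat_def)
qed

text \<open>Leaving the singleton \<open>{i}\<close> gives a nonzero entry in row \<open>i\<close>.
  Order 1 is treated apart, as \<open>{i}\<close> is then not a proper subset. Positivity makes the
  divisions in the row-normalization meaningful.\<close>

lemma irreducible_row_sum_pos:
  fixes A :: "real mat"
  assumes A: "A \<in> carrier_mat N N" and nn: "nonneg_mat A" and irr: "irreducible_mat A"
    and i: "i < N"
  shows "0 < (\<Sum>j < N. A $$ (i, j))"
proof -
  have "\<exists>k < N. A $$ (i, k) \<noteq> 0"
  proof (cases "N = 1")
    case True
    then show ?thesis using irr A i by (auto simp: irreducible_mat_def)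
  next
    case False
    then obtain k where "k < N" "k \<noteq> i"
      using i by (metis less_one linorder_neqE_nat not_less0 gr_zeroI)
    then have "{i} \<subset> {..<N}" using i by auto
    from irreducible_mat_edge[OF A irr this] show ?thesis by auto
  qed
  then obtain k where k: "k < N" "A $$ (i, k) \<noteq> 0" by blast
  have nonneg: "0 \<le> A $$ (i, j)" if "j < N" for j
    using nn A i that by (auto simp: nonneg_mat_def)
  have "0 < A $$ (i, k)" using nonneg[OF k(1)] k(2) by simp
  with k nonneg show ?thesis by (intro sum_pos2[of _ k]) auto
qed

lemma stochastic_row_normalization:
  assumes A: "A \<in> carrier_mat N N" and nn: "nonneg_mat A" and irr: "irreducible_mat A"
  shows "stochastic_mat N (row_normalization A)"
proof -
  note pos = irreducible_row_sum_pos[OF A nn irr]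
  have "0 \<le> A $$ (i, j)" if "i < N" "j < N" for i j
    using nn A that by (auto simp: nonneg_mat_def)
  moreover have "(\<Sum>j < N. row_normalization A $$ (i, j)) = 1" if "i < N" for i
    using A that pos[OF that] by (simp add: row_normalization_def flip: sum_divide_distrib)
  ultimately show ?thesis using A pos
    by (auto simp: stochastic_mat_def row_normalization_def nonneg_mat_def intro!: divide_nonneg_pos)
qed

subsection \<open>Spectrum of a stochastic matrix\<close>

text \<open>At an entry of maximal modulus \<open>m\<close>, the weighted average over the row has
  modulus at most \<open>m\<close>. The field is general because the spectral radius needs complex
  numbers and the determinant of \<open>I - l P\<close> real ones.\<close>

lemma stochastic_eigenvalue_bound:
  fixes z :: "nat \<Rightarrow> 'a :: real_normed_field"
  assumes P: "stochastic_mat N P"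
    and ev: "\<And>i. i < N \<Longrightarrow> (\<Sum>j < N. of_real (P $$ (i, j)) * z j) = \<mu> * z i"
    and nz: "\<exists>i < N. z i \<noteq> 0"
  shows "norm \<mu> \<le> 1"
proof -
  note P = stochastic_matD[OF P]
  define m where "m = Max ((\<lambda>i. norm (z i)) ` {..<N})"
  have "N \<noteq> 0" using nz by auto
  then have "m \<in> (\<lambda>i. norm (z i)) ` {..<N}" unfolding m_def by (intro Max_in) auto
  then obtain i where i: "i < N" "m = norm (z i)" by auto
  have le: "norm (z j) \<le> m" if "j < N" for j using that unfolding m_def by (intro Max_ge) auto
  have "norm \<mu> * m = norm (\<Sum>j < N. of_real (P $$ (i, j)) * z j)"
    using ev[OF i(1)] i by (simp add: norm_mult)
  also have "\<dots> \<le> (\<Sum>j < N. P $$ (i, j) * m)"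
    using P(2)[OF i(1)] le by (intro sum_norm_le) (auto simp: norm_mult intro!: mult_left_mono)
  also have "\<dots> = m" using P(3)[OF i(1)] by (simp flip: sum_distrib_right)
  finally have "norm \<mu> * m \<le> 1 * m" by simp
  moreover have "m > 0" using nz le by (metis less_le_trans zero_less_norm_iff)
  ultimately show ?thesis by (simp only: mult_le_cancel_right_pos)
qed

text \<open>All eigenvalues have modulus at most 1, and the all-ones vector has eigenvalue
  1.\<close>

lemma stochastic_spectral_radius:
  assumes P: "stochastic_mat N P" and N: "0 < N"
  shows "spectral_radius (map_mat complex_of_real P) = 1"
proof -
  note Ps = stochastic_matD[OF P]
  let ?C = "map_mat complex_of_real P"
  have C: "?C \<in> carrier_mat N N" using Ps by auto
  have "norm \<mu> \<le> 1" if ev: "eigenvalue ?C \<mu>" for \<mu>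
  proof -
    obtain z where z: "z \<in> carrier_vec N" "z \<noteq> 0\<^sub>v N" "?C *\<^sub>v z = \<mu> \<cdot>\<^sub>v z"
      using ev C by (auto simp: eigenvalue_def eigenvector_def)
    show ?thesis
    proof (rule stochastic_eigenvalue_bound[OF P])
      show "\<exists>i < N. z $ i \<noteq> 0" using z by (metis eq_vecI carrier_vecD index_zero_vec)
      fix i assume i: "i < N"
      show "(\<Sum>j < N. of_real (P $$ (i, j)) * z $ j) = \<mu> * z $ i"
        using mult_mat_vec_index_sum[OF C z(1) i] z i Ps(1) by simp
    qed
  qed
  moreover have "eigenvector ?C (vec N (\<lambda>_. 1)) 1"
  proof -
    have "?C *\<^sub>v vec N (\<lambda>_. 1) = 1 \<cdot>\<^sub>v vec N (\<lambda>_. 1)"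
    proof (rule eq_vecI)
      fix i assume "i < dim_vec (1 \<cdot>\<^sub>v vec N (\<lambda>_. 1 :: complex))"
      then have i: "i < N" by simp
      have "(?C *\<^sub>v vec N (\<lambda>_. 1)) $ i = (\<Sum>j < N. complex_of_real (P $$ (i, j)))"
        using i Ps(1) by (subst mult_mat_vec_index_sum[OF C]) auto
      also have "\<dots> = 1" using Ps(3)[OF i] by (simp flip: of_real_sum)
      finally show "(?C *\<^sub>v vec N (\<lambda>_. 1)) $ i = (1 \<cdot>\<^sub>v vec N (\<lambda>_. 1)) $ i" using i by simp
    qed (use C in auto)
    moreover have "vec N (\<lambda>_. 1 :: complex) \<noteq> 0\<^sub>v N"
      using N by (metis index_vec index_zero_vec(1) zero_neq_one)
    ultimately show ?thesis using C by (auto simp: eigenvector_def)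
  qed
  then have "1 \<in> norm ` spectrum ?C"
    by (force simp: spectrum_def eigenvalue_def)
  then have "1 \<le> spectral_radius ?C" by (rule spectral_radius_mem_max(2)[OF C N])
  \<comment> \<open>The spectral radius is attained by an eigenvalue, and
    \<open>calculation(1)\<close> is the bound on eigenvalues proved first.\<close>
  moreover have "spectral_radius ?C \<le> 1"
    using spectral_radius_mem_max(1)[OF C N] calculation(1) by (auto simp: spectrum_def)
  ultimately show ?thesis by simp
qed

text \<open>The all-ones vector gives \<open>P\<close> the eigenvalue 1, and \<open>P\<close> has
  the same characteristic polynomial as its transpose. The signs of the entries remain open
  here.\<close>

lemma stochastic_left_eigenvector_exists:
  assumes P: "stochastic_mat N P" and N: "0 < N"
  shows "\<exists>c \<in> carrier_mat N 1. (\<exists>i < N. c $$ (i, 0) \<noteq> 0) \<and> transpose_mat c * P = transpose_mat c"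
proof -
  note Ps = stochastic_matD[OF P]
  have "eigenvector P (vec N (\<lambda>_. 1)) 1"
  proof -
    have "P *\<^sub>v vec N (\<lambda>_. 1) = 1 \<cdot>\<^sub>v vec N (\<lambda>_. 1)"
      using Ps by (intro eq_vecI) (auto simp: mult_mat_vec_index_sum[OF Ps(1)] simp del: index_mult_mat_vec)
    moreover have "vec N (\<lambda>_. 1 :: real) \<noteq> 0\<^sub>v N"
      using N by (metis index_vec index_zero_vec(1) zero_neq_one)
    ultimately show ?thesis using Ps by (auto simp: eigenvector_def)
  qed
  then have "eigenvalue P 1" by (auto simp: eigenvalue_def)
  then have "eigenvalue (transpose_mat P) 1"
    using Ps(1) by (simp add: eigenvalue_root_char_poly[of _ N])
  then obtain z where z: "z \<in> carrier_vec N" "z \<noteq> 0\<^sub>v N" "transpose_mat P *\<^sub>v z = 1 \<cdot>\<^sub>v z"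
    using Ps(1) by (auto simp: eigenvalue_def eigenvector_def)
  define c where "c = mat N 1 (\<lambda>(i, j). z $ i)"
  have c: "c \<in> carrier_mat N 1" by (simp add: c_def)
  have "transpose_mat c * P = transpose_mat c"
  proof (rule eq_matI)
    fix i j assume "i < dim_row (transpose_mat c)" "j < dim_col (transpose_mat c)"
    then have ij: "i = 0" "j < N" using c by auto
    have "(transpose_mat c * P) $$ (0, j) = (\<Sum>i < N. transpose_mat P $$ (j, i) * z $ i)"
      using ij Ps(1) by (subst row_mult_index_sum[OF c Ps(1)]) (auto simp: c_def mult.commute)
    also have "\<dots> = z $ j"
      using mult_mat_vec_index_sum[of "transpose_mat P" N N z j] z ij Ps(1) by simp
    finally show "(transpose_mat c * P) $$ (i, j) = transpose_mat c $$ (i, j)"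
      using ij by (simp add: c_def)
  qed (use c Ps in auto)
  moreover have "\<exists>i < N. z $ i \<noteq> 0" using z by (metis eq_vecI carrier_vecD index_zero_vec)
  ultimately show ?thesis using c by (intro bexI[of _ c]) (auto simp: c_def)
qed

subsection \<open>The resolvent\<close>

text \<open>A kernel vector would be an eigenvector of \<open>P\<close> for \<open>1 / l\<close>,
  which exceeds 1.\<close>

lemma stochastic_resolvent_det:
  assumes P: "stochastic_mat N P" and l: "0 < l" "l < 1"
  shows "det (1\<^sub>m N - l \<cdot>\<^sub>m P) \<noteq> 0"
proof
  note Ps = stochastic_matD[OF P]
  let ?B = "1\<^sub>m N - l \<cdot>\<^sub>m P"
  have B: "?B \<in> carrier_mat N N" using Ps by auto
  assume "det ?B = 0"
  then obtain z where z: "z \<in> carrier_vec N" "z \<noteq> 0\<^sub>v N" "?B *\<^sub>v z = 0\<^sub>v N"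
    using det_0_iff_vec_prod_zero_field[OF B] by auto
  have "norm (1 / l) \<le> 1"
  proof (rule stochastic_eigenvalue_bound[OF P])
    show "\<exists>i < N. z $ i \<noteq> 0" using z by (metis eq_vecI carrier_vecD index_zero_vec)
    fix i assume i: "i < N"
    have "0 = (\<Sum>j < N. ?B $$ (i, j) * z $ j)"
      using mult_mat_vec_index_sum[OF B z(1) i] z i by simp
    also have "\<dots> = (\<Sum>j < N. (if j = i then z $ j else 0) - l * (P $$ (i, j) * z $ j))"
      using i Ps(1) by (intro sum.cong) (auto simp: algebra_simps)
    also have "\<dots> = z $ i - l * (\<Sum>j < N. P $$ (i, j) * z $ j)"
      using i by (simp add: sum_subtractf sum_distrib_left)
    finally show "(\<Sum>j < N. of_real (P $$ (i, j)) * z $ j) = 1 / l * z $ i"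
      using l by (simp add: field_simps)
  qed
  then show False using l by simp
qed

text \<open>A nonzero determinant excludes \<open>None\<close>, so \<open>the\<close> returns the
  true inverse.\<close>

lemma mat_inverse_det_nonzero:
  fixes B :: "'a :: field mat"
  assumes B: "B \<in> carrier_mat N N" and "det B \<noteq> 0"
  shows "the (mat_inverse B) \<in> carrier_mat N N" "B * the (mat_inverse B) = 1\<^sub>m N"
    "the (mat_inverse B) * B = 1\<^sub>m N"
proof -
  obtain C where "mat_inverse B = Some C"
    using mat_inverse(1)[OF B, of "()"] det_non_zero_imp_unit[OF assms, of "()"] by blast
  with mat_inverse(2)[OF B this]
  show "the (mat_inverse B) \<in> carrier_mat N N" "B * the (mat_inverse B) = 1\<^sub>m N"
    "the (mat_inverse B) * B = 1\<^sub>m N" by auto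
qed

text \<open>Both orders of the product are needed: the resolvent as right factor governs its columns
  and fixed rows, as left factor its row sums.\<close>

lemma resolvent_mat_inverse:
  assumes P: "stochastic_mat N P" and l: "0 < l" "l < 1"
  shows "resolvent_mat P l \<in> carrier_mat N N"
    "(1\<^sub>m N - l \<cdot>\<^sub>m P) * resolvent_mat P l = (1 - l) \<cdot>\<^sub>m 1\<^sub>m N"
    "resolvent_mat P l * (1\<^sub>m N - l \<cdot>\<^sub>m P) = (1 - l) \<cdot>\<^sub>m 1\<^sub>m N"
proof -
  have PC: "P \<in> carrier_mat N N" using stochastic_matD(1)[OF P] .
  have B: "1\<^sub>m N - l \<cdot>\<^sub>m P \<in> carrier_mat N N" using PC by auto
  note inv = mat_inverse_det_nonzero[OF B stochastic_resolvent_det[OF P l]]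
  have X: "resolvent_mat P l = (1 - l) \<cdot>\<^sub>m the (mat_inverse (1\<^sub>m N - l \<cdot>\<^sub>m P))"
    using PC by (auto simp: resolvent_mat_def)
  show "resolvent_mat P l \<in> carrier_mat N N" using inv X by simp
  show "(1\<^sub>m N - l \<cdot>\<^sub>m P) * resolvent_mat P l = (1 - l) \<cdot>\<^sub>m 1\<^sub>m N"
    unfolding X using mult_smult_distrib[OF B inv(1)] inv(2) by simp
  show "resolvent_mat P l * (1\<^sub>m N - l \<cdot>\<^sub>m P) = (1 - l) \<cdot>\<^sub>m 1\<^sub>m N"
    unfolding X using mult_smult_assoc_mat[OF inv(1) B] inv(3) by simp
qed

text \<open>With \<open>B = I - l P\<close>, the row vector \<open>c\<close> satisfies
  \<open>c B = (1 - l) c\<close>. Multiplying by the resolvent on the right and cancelling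
  \<open>1 - l\<close> gives the claim.\<close>

lemma resolvent_mat_fixed_row:
  assumes P: "stochastic_mat N P" and l: "0 < l" "l < 1"
    and c: "c \<in> carrier_mat N 1" and fixed: "transpose_mat c * P = transpose_mat c"
  shows "transpose_mat c * resolvent_mat P l = transpose_mat c"
proof -
  let ?X = "resolvent_mat P l" and ?B = "1\<^sub>m N - l \<cdot>\<^sub>m P" and ?c = "transpose_mat c"
  note Ps = stochastic_matD(1)[OF P]
  note X = resolvent_mat_inverse[OF P l]
  have ct: "?c \<in> carrier_mat 1 N" and B: "?B \<in> carrier_mat N N" using c Ps by auto
  have "?c * ?B = ?c * 1\<^sub>m N - ?c * (l \<cdot>\<^sub>m P)"
    using Ps ct by (intro mult_minus_distrib_mat) auto
  also have "\<dots> = (1 - l) \<cdot>\<^sub>m ?c"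
    using ct Ps mult_smult_distrib[OF ct Ps, of l] fixed
    by (intro eq_matI) (auto simp: algebra_simps)
  finally have cB: "?c * ?B = (1 - l) \<cdot>\<^sub>m ?c" .
  have "(1 - l) \<cdot>\<^sub>m (?c * ?X) = ?c * ?B * ?X"
    unfolding cB using mult_smult_assoc_mat[OF ct X(1)] by simp
  also have "\<dots> = ?c * (?B * ?X)" by (rule assoc_mult_mat[OF ct B X(1)])
  also have "\<dots> = (1 - l) \<cdot>\<^sub>m ?c"
    unfolding X(2) using ct mult_smult_distrib[OF ct, of "1\<^sub>m N" N "1 - l"] by simp
  finally have eq: "(1 - l) \<cdot>\<^sub>m (?c * ?X) = (1 - l) \<cdot>\<^sub>m ?c" .
  show ?thesis
  proof (rule eq_matI)
    fix i j assume ij: "i < dim_row ?c" "j < dim_col ?c"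
    have "((1 - l) \<cdot>\<^sub>m (?c * ?X)) $$ (i, j) = ((1 - l) \<cdot>\<^sub>m ?c) $$ (i, j)" using eq by simp
    then show "(?c * ?X) $$ (i, j) = ?c $$ (i, j)" using ij l X(1) ct
      by (auto simp del: index_mult_mat(1) simp: index_smult_mat)
  qed (use X(1) ct in auto)
qed

text \<open>The all-ones column \<open>e\<close> satisfies \<open>B e = (1 - l) e\<close>; applying
  the resolvent \<open>X\<close> on the left gives \<open>(1 - l) e = (1 - l) X e\<close>.\<close>

lemma resolvent_mat_row_sum:
  assumes P: "stochastic_mat N P" and l: "0 < l" "l < 1" and i: "i < N"
  shows "(\<Sum>j < N. resolvent_mat P l $$ (i, j)) = 1"
proof -
  let ?X = "resolvent_mat P l" and ?B = "1\<^sub>m N - l \<cdot>\<^sub>m P"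
  note Ps = stochastic_matD[OF P]
  note X = resolvent_mat_inverse[OF P l]
  have B: "?B \<in> carrier_mat N N" using Ps by auto
  have Brow: "(\<Sum>j < N. ?B $$ (k, j)) = 1 - l" if k: "k < N" for k
  proof -
    have "(\<Sum>j < N. ?B $$ (k, j)) = (\<Sum>j < N. (if j = k then 1 else 0) - l * P $$ (k, j))"
      using k Ps(1) by (intro sum.cong) auto
    then show ?thesis using k Ps(3)[OF k] by (simp add: sum_subtractf flip: sum_distrib_left)
  qed
  have "1 - l = (\<Sum>j < N. ((1 - l) \<cdot>\<^sub>m 1\<^sub>m N) $$ (i, j))"
    using i by (simp add: if_distrib[of "\<lambda>x. _ * x"] cong: if_cong)
  also have "\<dots> = (\<Sum>j < N. \<Sum>k < N. ?X $$ (i, k) * ?B $$ (k, j))"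
    unfolding X(3)[symmetric] using i by (intro sum.cong mult_mat_index_sum[OF X(1) B]) auto
  also have "\<dots> = (\<Sum>k < N. ?X $$ (i, k) * (\<Sum>j < N. ?B $$ (k, j)))"
    by (subst sum.swap) (simp add: sum_distrib_left)
  also have "\<dots> = (\<Sum>k < N. ?X $$ (i, k)) * (1 - l)"
    using Brow by (simp add: sum_distrib_right)
  finally show ?thesis using l by simp
qed

text \<open>A column \<open>y\<close> of the resolvent satisfies \<open>y = (1 - l) e\<^sub>j + l P y\<close>. Comparing both sides
  at a minimal entry gives \<open>y \<ge> 0\<close>; then the zero set of \<open>y\<close> is closed under the transitions of
  \<open>P\<close> and misses \<open>j\<close>, so it is empty by irreducibility.\<close>

lemma resolvent_mat_pos:
  assumes P: "stochastic_mat N P" and l: "0 < l" "l < 1"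
    and edge: "\<And>S. S \<subset> {..<N} \<Longrightarrow> S \<noteq> {} \<Longrightarrow> \<exists>i \<in> S. \<exists>j \<in> {..<N} - S. P $$ (i, j) \<noteq> 0"
    and i: "i < N" and j: "j < N"
  shows "0 < resolvent_mat P l $$ (i, j)"
proof -
  let ?X = "resolvent_mat P l" and ?B = "1\<^sub>m N - l \<cdot>\<^sub>m P"
  note Ps = stochastic_matD[OF P]
  note X = resolvent_mat_inverse[OF P l]
  have B: "?B \<in> carrier_mat N N" using Ps by auto
  define y where "y k = ?X $$ (k, j)" for k
  have eq: "y k = (if k = j then 1 - l else 0) + l * (\<Sum>m < N. P $$ (k, m) * y m)"
    if k: "k < N" for k
  proof -
    have "(if k = j then 1 - l else 0) = ((1 - l) \<cdot>\<^sub>m 1\<^sub>m N) $$ (k, j)" using k j by simp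
    also have "\<dots> = (\<Sum>m < N. ?B $$ (k, m) * y m)"
      unfolding X(2)[symmetric] y_def by (rule mult_mat_index_sum[OF B X(1) k j])
    also have "\<dots> = (\<Sum>m < N. (if m = k then y m else 0) - l * (P $$ (k, m) * y m))"
      using k Ps(1) by (intro sum.cong) (auto simp: algebra_simps)
    also have "\<dots> = y k - l * (\<Sum>m < N. P $$ (k, m) * y m)"
      using k by (simp add: sum_subtractf sum_distrib_left)
    finally show ?thesis by simp
  qed
  define m where "m = Min (y ` {..<N})"
  have "m \<in> y ` {..<N}" unfolding m_def using i by (intro Min_in) auto
  then obtain k where k: "k < N" "y k = m" by auto
  have le: "m \<le> y n" if "n < N" for n using that unfolding m_def by (intro Min_le) auto
  have "m = (\<Sum>n < N. P $$ (k, n) * m)" using Ps(3)[OF k(1)] by (simp flip: sum_distrib_right)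
  also have "\<dots> \<le> (\<Sum>n < N. P $$ (k, n) * y n)"
    using le Ps(2)[OF k(1)] by (intro sum_mono mult_left_mono) auto
  finally have "l * m \<le> l * (\<Sum>n < N. P $$ (k, n) * y n)" using l by simp
  moreover have "0 \<le> (if k = j then 1 - l else 0)" using l by simp
  ultimately have "l * m \<le> m" using eq[OF k(1)] k(2) by linarith
  then have "0 \<le> (1 - l) * m" by (simp add: algebra_simps)
  then have "0 \<le> m" using l by (simp add: zero_le_mult_iff)
  then have y0: "0 \<le> y n" if "n < N" for n using le[OF that] by simp
  have Py0: "0 \<le> P $$ (a, n) * y n" if "a < N" "n < N" for a n
    using y0 Ps(2) that by simp
  define S where "S = {n. n < N \<and> y n = 0}"
  have "0 < y j"
  proof -
    have "0 \<le> l * (\<Sum>m < N. P $$ (j, m) * y m)"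
      using sum_nonneg[of "{..<N}" "\<lambda>m. P $$ (j, m) * y m"] Py0 j l by simp
    then show ?thesis using eq[OF j] l by simp
  qed
  then have "j \<notin> S" by (simp add: S_def)
  moreover have "S \<subseteq> {..<N}" by (auto simp: S_def)
  ultimately have "S \<subset> {..<N}" using j by blast
  \<comment> \<open>For \<open>a\<close> in \<open>S\<close> the equation writes 0 as a sum of
    non-negative terms, so each \<open>P $$ (a, b) * y b\<close> vanishes, while \<open>y b\<close>
    is nonzero outside \<open>S\<close>.\<close>
  moreover have "P $$ (a, b) = 0" if a: "a \<in> S" and b: "b \<in> {..<N} - S" for a b
  proof -
    have "0 \<le> (\<Sum>m < N. P $$ (a, m) * y m)" using Py0 a by (intro sum_nonneg) (auto simp: S_def)
    then have "0 \<le> l * (\<Sum>m < N. P $$ (a, m) * y m)" using l by simp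
    then have "l * (\<Sum>m < N. P $$ (a, m) * y m) = 0"
      using eq[of a] a l by (auto simp: S_def split: if_splits)
    then have "(\<Sum>m < N. P $$ (a, m) * y m) = 0" using l by simp
    then have "P $$ (a, b) * y b = 0"
      using Py0 a b by (subst (asm) sum_nonneg_eq_0_iff) (auto simp: S_def)
    then show ?thesis using b by (auto simp: S_def)
  qed
  ultimately have "S = {}" using edge[of S] by blast
  then have "y i \<noteq> 0" using i by (auto simp: S_def)
  then show ?thesis using y0[OF i] by (simp add: y_def)
qed

subsection \<open>Contraction on zero-sum vectors\<close>

text \<open>On a zero-sum row vector \<open>w\<close>, \<open>X\<close> acts as \<open>X - d J\<close> with \<open>J\<close> the all-ones matrix; the
  latter is non-negative with row sums \<open>1 - N d\<close>.\<close>

lemma zero_sum_contraction: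
  fixes X :: "nat \<Rightarrow> nat \<Rightarrow> real"
  assumes d: "\<And>i j. i < N \<Longrightarrow> j < N \<Longrightarrow> d \<le> X i j"
    and X: "\<And>i. i < N \<Longrightarrow> (\<Sum>j < N. X i j) = 1" and w: "(\<Sum>i < N. w i) = 0"
  shows "(\<Sum>j < N. \<bar>\<Sum>i < N. w i * X i j\<bar>) \<le> (1 - real N * d) * (\<Sum>i < N. \<bar>w i\<bar>)"
proof -
  have "(\<Sum>i < N. w i * X i j) = (\<Sum>i < N. w i * (X i j - d))" for j
    using w by (simp add: algebra_simps sum_subtractf flip: sum_distrib_left)
  then have "(\<Sum>j < N. \<bar>\<Sum>i < N. w i * X i j\<bar>) \<le> (\<Sum>j < N. \<Sum>i < N. \<bar>w i\<bar> * (X i j - d))"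
    using d by (auto intro!: sum_mono order.trans[OF sum_abs] simp: abs_mult)
  also have "\<dots> = (\<Sum>i < N. \<bar>w i\<bar> * (\<Sum>j < N. X i j - d))"
    by (subst sum.swap) (simp add: sum_distrib_left)
  also have "\<dots> = (\<Sum>i < N. \<bar>w i\<bar> * (1 - real N * d))"
    using X by (intro sum.cong) (auto simp: sum_subtractf)
  finally show ?thesis by (simp add: sum_distrib_left mult.commute)
qed

text \<open>Every step multiplies the sum of absolute values by at most a fixed
  \<open>q < 1\<close>, so the decay is geometric.\<close>

lemma zero_sum_iterates_tendsto_0:
  fixes X :: "nat \<Rightarrow> nat \<Rightarrow> real"
  assumes pos: "\<And>i j. i < N \<Longrightarrow> j < N \<Longrightarrow> 0 < X i j"
    and X: "\<And>i. i < N \<Longrightarrow> (\<Sum>j < N. X i j) = 1"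
    and w0: "(\<Sum>i < N. w 0 i) = 0"
    and step: "\<And>k j. j < N \<Longrightarrow> w (Suc k) j = (\<Sum>i < N. w k i * X i j)"
    and j: "j < N"
  shows "(\<lambda>k. w k j) \<longlonglongrightarrow> 0"
proof -
  \<comment> \<open>The smallest entry of \<open>X\<close> is the uniform lower bound; it is
    positive as a minimum of finitely many positive numbers.\<close>
  define d where "d = Min ((\<lambda>(i, j). X i j) ` ({..<N} \<times> {..<N}))"
  have dle: "d \<le> X a b" if "a < N" "b < N" for a b
    unfolding d_def by (rule Min_le) (use that in auto)
  have "d \<in> (\<lambda>(i, j). X i j) ` ({..<N} \<times> {..<N})"
    unfolding d_def using j by (intro Min_in) auto
  then have "0 < d" using pos by auto
  define q where "q = 1 - real N * d"
  \<comment> \<open>A row sum is at least \<open>N * d\<close>, which gives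
    \<open>0 \<le> q\<close>; this sign is needed to iterate the bound.\<close>
  have "(\<Sum>b < N. d) \<le> (\<Sum>b < N. X j b)" using dle j by (intro sum_mono) auto
  then have q: "0 \<le> q" "q < 1" using X[OF j] j \<open>0 < d\<close> by (auto simp: q_def)
  \<comment> \<open>Row sums 1 preserve the total, so the contraction can be applied again at each
    step.\<close>
  have zero: "(\<Sum>i < N. w k i) = 0" for k
  proof (induction k)
    case (Suc k)
    have "(\<Sum>j < N. w (Suc k) j) = (\<Sum>j < N. \<Sum>i < N. w k i * X i j)" using step by simp
    also have "\<dots> = (\<Sum>i < N. w k i * (\<Sum>j < N. X i j))"
      by (subst sum.swap) (simp add: sum_distrib_left)
    also have "\<dots> = 0" using X Suc by simp
    finally show ?case .
  qed (rule w0)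
  have bound: "(\<Sum>i < N. \<bar>w k i\<bar>) \<le> q ^ k * (\<Sum>i < N. \<bar>w 0 i\<bar>)" for k
  proof (induction k)
    case (Suc k)
    have "(\<Sum>i < N. \<bar>w (Suc k) i\<bar>) \<le> q * (\<Sum>i < N. \<bar>w k i\<bar>)"
      using zero_sum_contraction[OF dle X zero[of k]] step by (simp add: q_def)
    also have "\<dots> \<le> q * (q ^ k * (\<Sum>i < N. \<bar>w 0 i\<bar>))" using Suc q by (rule_tac mult_left_mono) auto
    finally show ?case by simp
  qed simp
  have lim: "(\<lambda>k. q ^ k * (\<Sum>i < N. \<bar>w 0 i\<bar>)) \<longlonglongrightarrow> 0"
    using q by (intro tendsto_mult_left_zero LIMSEQ_realpow_zero)
  have "\<bar>w k j\<bar> \<le> q ^ k * (\<Sum>i < N. \<bar>w 0 i\<bar>)" for k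
    using bound[of k] member_le_sum[of j "{..<N}" "\<lambda>i. \<bar>w k i\<bar>"] j by simp
  \<comment> \<open>The outer absolute value is the norm that \<open>tendsto_0_le\<close> compares
    with.\<close>
  then have le: "\<bar>w k j\<bar> \<le> \<bar>q ^ k * (\<Sum>i < N. \<bar>w 0 i\<bar>)\<bar>" for k
    by (rule order_trans) simp
  show ?thesis
    by (rule tendsto_0_le[OF lim, where K = 1]) (use le in simp)
qed

text \<open>The difference \<open>u k - c\<close> obeys the same recursion and starts with sum
  0.\<close>

lemma iterates_tendsto_fixed_row:
  fixes X :: "nat \<Rightarrow> nat \<Rightarrow> real"
  assumes pos: "\<And>i j. i < N \<Longrightarrow> j < N \<Longrightarrow> 0 < X i j"
    and X: "\<And>i. i < N \<Longrightarrow> (\<Sum>j < N. X i j) = 1"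
    and u: "\<And>k j. j < N \<Longrightarrow> u (Suc k) j = (\<Sum>i < N. u k i * X i j)"
    and c: "\<And>j. j < N \<Longrightarrow> (\<Sum>i < N. c i * X i j) = c j"
    and s: "(\<Sum>i < N. u 0 i) = (\<Sum>i < N. c i)"
    and j: "j < N"
  shows "(\<lambda>k. u k j) \<longlonglongrightarrow> c j"
proof -
  have "(\<lambda>k. u k j - c j) \<longlonglongrightarrow> 0"
    by (rule zero_sum_iterates_tendsto_0[where X = X and N = N and w = "\<lambda>k j. u k j - c j"])
       (use assms in \<open>auto simp: sum_subtractf left_diff_distrib\<close>)
  then show ?thesis by (simp add: LIM_zero_iff)
qed

text \<open>The constant sequence \<open>b\<close> is an orbit of \<open>X\<close>, so it converges
  to \<open>c\<close> and hence equals it.\<close>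

lemma fixed_row_eq:
  fixes X :: "nat \<Rightarrow> nat \<Rightarrow> real"
  assumes "\<And>i j. i < N \<Longrightarrow> j < N \<Longrightarrow> 0 < X i j"
    and "\<And>i. i < N \<Longrightarrow> (\<Sum>j < N. X i j) = 1"
    and "\<And>j. j < N \<Longrightarrow> (\<Sum>i < N. b i * X i j) = b j"
    and "\<And>j. j < N \<Longrightarrow> (\<Sum>i < N. c i * X i j) = c j"
    and "(\<Sum>i < N. b i) = (\<Sum>i < N. c i)" and "j < N"
  shows "b j = c j"
  using iterates_tendsto_fixed_row[where u = "\<lambda>_. b" and X = X and c = c and N = N and j = j] assms
  by (simp add: LIMSEQ_const_iff)

subsection \<open>The Perron vector\<close>

text \<open>Spectral radius 1 turns the eigenvector equation into a fixed-row equation.\<close>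

lemma left_perron_vector_stochastic_iff:
  assumes P: "stochastic_mat N P" and N: "0 < N"
  shows "left_perron_vector P q \<longleftrightarrow>
    q \<in> carrier_mat N 1 \<and> transpose_mat q * P = transpose_mat q \<and> positive_mat q \<and>
    (\<Sum>i < N. q $$ (i, 0)) = 1"
proof -
  have "(1::real) \<cdot>\<^sub>m transpose_mat q = transpose_mat q" by (intro eq_matI) auto
  then show ?thesis
    using stochastic_matD(1)[OF P] stochastic_spectral_radius[OF P N]
    by (auto simp: left_perron_vector_def)
qed

lemma resolvent_fixed_row_sum:
  assumes P: "stochastic_mat N P" and l: "0 < l" "l < 1"
    and c: "c \<in> carrier_mat N 1" and fixed: "transpose_mat c * P = transpose_mat c"
    and j: "j < N"
  shows "(\<Sum>i < N. c $$ (i, 0) * resolvent_mat P l $$ (i, j)) = c $$ (j, 0)"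
  using row_mult_index_sum[OF c resolvent_mat_inverse(1)[OF P l] j]
    resolvent_mat_fixed_row[OF P l c fixed] c j by simp

text \<open>A nonzero left fixed vector has nonzero sum, since \<open>X\<close> contracts zero-sum vectors. Once
  normalised it is the limit of the iterates of the uniform distribution, hence non-negative, and
  one application of the positive matrix \<open>X\<close> makes it positive.\<close>

lemma left_perron_vector_exists:
  assumes P: "stochastic_mat N P" and N: "0 < N" and l: "0 < l" "l < 1"
    and pos: "\<And>i j. i < N \<Longrightarrow> j < N \<Longrightarrow> 0 < resolvent_mat P l $$ (i, j)"
  shows "\<exists>c. left_perron_vector P c"
proof -
  note Ps = stochastic_matD[OF P]
  define X where "X i j = resolvent_mat P l $$ (i, j)" for i j
  have Xpos: "\<And>i j. i < N \<Longrightarrow> j < N \<Longrightarrow> 0 < X i j" using pos by (simp add: X_def)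
  have Xsum: "\<And>i. i < N \<Longrightarrow> (\<Sum>j < N. X i j) = 1"
    using resolvent_mat_row_sum[OF P l] by (simp add: X_def)
  obtain b where b: "b \<in> carrier_mat N 1" "\<exists>i < N. b $$ (i, 0) \<noteq> 0"
    "transpose_mat b * P = transpose_mat b"
    using stochastic_left_eigenvector_exists[OF P N] by blast
  define t where "t = (\<Sum>i < N. b $$ (i, 0))"
  have bX: "\<And>j. j < N \<Longrightarrow> (\<Sum>i < N. b $$ (i, 0) * X i j) = b $$ (j, 0)"
    using resolvent_fixed_row_sum[OF P l b(1,3)] by (simp add: X_def)
  have t: "t \<noteq> 0"
  proof
    assume "t = 0"
    \<comment> \<open>The zero row is also fixed by \<open>X\<close> and has the same sum, so
      uniqueness identifies \<open>b\<close> with it.\<close>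
    then have "b $$ (j, 0) = 0" if "j < N" for j
      using fixed_row_eq[where X = X and N = N and b = "\<lambda>i. b $$ (i, 0)" and c = "\<lambda>_. 0" and j = j]
        Xpos Xsum bX that by (simp add: t_def)
    then show False using b(2) by auto
  qed
  define c where "c = (1 / t) \<cdot>\<^sub>m b"
  have c: "c \<in> carrier_mat N 1" using b by (simp add: c_def)
  have ci: "c $$ (i, 0) = b $$ (i, 0) / t" if "i < N" for i using that b by (simp add: c_def)
  have "transpose_mat c = (1 / t) \<cdot>\<^sub>m transpose_mat b"
    using b by (intro eq_matI) (auto simp: c_def)
  then have fixP: "transpose_mat c * P = transpose_mat c"
    using mult_smult_assoc_mat[of "transpose_mat b" 1 N P N "1 / t"] b Ps(1) by simp
  have csum: "(\<Sum>i < N. c $$ (i, 0)) = 1"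
    using ci t by (simp add: t_def flip: sum_divide_distrib)
  have cX: "\<And>j. j < N \<Longrightarrow> (\<Sum>i < N. c $$ (i, 0) * X i j) = c $$ (j, 0)"
    using resolvent_fixed_row_sum[OF P l c fixP] by (simp add: X_def)
  \<comment> \<open>The start \<open>1 / N\<close> has sum 1, matching the sum of \<open>c\<close>
    as convergence to \<open>c\<close> requires.\<close>
  define u where "u = rec_nat (\<lambda>_. 1 / real N) (\<lambda>_ w j. \<Sum>i < N. w i * X i j)"
  have u0: "u 0 = (\<lambda>_. 1 / real N)" and uS: "\<And>k j. u (Suc k) j = (\<Sum>i < N. u k i * X i j)"
    by (simp_all add: u_def)
  have unn: "0 \<le> u k j" if "j < N" for k j
    using that
    by (induction k arbitrary: j)
       (auto simp: u0 uS intro!: sum_nonneg mult_nonneg_nonneg Xpos[THEN less_imp_le])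
  have cnn: "0 \<le> c $$ (j, 0)" if j: "j < N" for j
  proof (rule LIMSEQ_le_const)
    have "(\<Sum>i < N. u 0 i) = (\<Sum>i < N. c $$ (i, 0))" using csum N by (simp add: u0)
    then show "(\<lambda>k. u k j) \<longlonglongrightarrow> c $$ (j, 0)"
      using j
      by (intro iterates_tendsto_fixed_row[where X = X and N = N and c = "\<lambda>i. c $$ (i, 0)"]
          Xpos Xsum uS cX)
  qed (use unn j in auto)
  \<comment> \<open>This single nonzero entry, spread by the positive row \<open>m\<close> of
    \<open>X\<close>, makes every entry of \<open>c\<close> positive.\<close>
  obtain m where m: "m < N" "c $$ (m, 0) \<noteq> 0"
    using b(2) ci t by auto
  have "0 < c $$ (j, 0)" if j: "j < N" for j
  proof -
    have "0 < c $$ (m, 0) * X m j" using m cnn[of m] Xpos[of m j] j by simp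
    then have "0 < (\<Sum>i < N. c $$ (i, 0) * X i j)"
      using m cnn Xpos j
      by (intro sum_pos2[of _ m]) (auto intro!: mult_nonneg_nonneg Xpos[THEN less_imp_le])
    then show ?thesis using cX[OF j] by simp
  qed
  then have "positive_mat c" using c by (auto simp: positive_mat_def)
  then show ?thesis
    using left_perron_vector_stochastic_iff[OF P N] c fixP csum by auto
qed

text \<open>Invertibility is part of the conclusion so that the resolvent has its intended value,
  and unique existence of the Perron vector so that the final convergence claim is not
  vacuous.\<close>

theorem theorem1:
  fixes A P v :: "real mat" and N :: nat and l :: real and x :: "nat \<Rightarrow> real mat"
  assumes "A \<in> carrier_mat N N" and "nonneg_mat A" and "irreducible_mat A"
    and "P = row_normalization A"
    and "0 < l" and "l < 1"
    and "personalization_vector N v" and "(\<Sum>i < N. \<bar>v $$ (i, 0)\<bar>) = 1"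
    and "x 0 = v"
    and "\<And>k. 1 \<le> k \<Longrightarrow> transpose_mat (x k) = transpose_mat (x (k - 1)) * resolvent_mat P l"
  shows "invertible_mat (1\<^sub>m N - l \<cdot>\<^sub>m P) \<and>
    (\<forall>k \<ge> 1. transpose_mat (x k) = transpose_mat v * (resolvent_mat P l ^\<^sub>m k)) \<and>
    (\<exists>!c. left_perron_vector P c) \<and>
    (\<forall>c. left_perron_vector P c \<longrightarrow> mat_tendsto x c)"
proof -
  note A = assms(1-3) and l = assms(5,6)
  have N: "0 < N" using A by (auto simp: irreducible_mat_def)
  have P: "stochastic_mat N P" unfolding assms(4) by (rule stochastic_row_normalization[OF A])
  note Ps = stochastic_matD[OF P]
  \<comment> \<open>Dividing by positive row sums keeps the zero pattern, so the edges of
    \<open>A\<close> are edges of \<open>P\<close>.\<close>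
  have edge: "\<exists>i \<in> S. \<exists>j \<in> {..<N} - S. P $$ (i, j) \<noteq> 0" if S: "S \<subset> {..<N}" "S \<noteq> {}" for S
  proof -
    obtain i j where ij: "i \<in> S" "j \<in> {..<N} - S" "A $$ (i, j) \<noteq> 0"
      using irreducible_mat_edge[OF A(1,3) S] by blast
    then have "i < N" "j < N" using S by auto
    then have "P $$ (i, j) \<noteq> 0"
      using ij(3) irreducible_row_sum_pos[OF A, of i] A(1) by (simp add: assms(4) row_normalization_def)
    then show ?thesis using ij by blast
  qed
  let ?X = "resolvent_mat P l" and ?B = "1\<^sub>m N - l \<cdot>\<^sub>m P"
  have Xc: "?X \<in> carrier_mat N N" by (rule resolvent_mat_inverse(1)[OF P l])
  define M where "M i j = ?X $$ (i, j)" for i j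
  have Mpos: "0 < M i j" if "i < N" "j < N" for i j
    unfolding M_def by (rule resolvent_mat_pos[OF P l _ that]) (rule edge)
  have Msum: "(\<Sum>j < N. M i j) = 1" if "i < N" for i
    unfolding M_def by (rule resolvent_mat_row_sum[OF P l that])
  have B: "?B \<in> carrier_mat N N" using Ps by auto
  have inv: "invertible_mat ?B"
    using mat_inverse_det_nonzero[OF B stochastic_resolvent_det[OF P l]] B
    unfolding invertible_mat_def inverts_mat_def by (metis carrier_matD square_mat.simps)
  have v: "v \<in> carrier_mat N 1" "(\<Sum>i < N. v $$ (i, 0)) = 1"
    using assms(7) by (auto simp: personalization_vector_def)
  have xS: "transpose_mat (x (Suc k)) = transpose_mat (x k) * ?X" for k
    using assms(10)[of "Suc k"] by simp
  \<comment> \<open>The transposed recursion fixes the dimensions of \<open>x k\<close>, which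
    \<open>mat_tendsto\<close> demands for every \<open>k\<close>.\<close>
  have xc: "x k \<in> carrier_mat N 1" for k
  proof (induction k)
    case (Suc k)
    then have "transpose_mat (x (Suc k)) \<in> carrier_mat 1 N" unfolding xS using Xc by simp
    then show ?case by simp
  qed (use v assms(9) in simp)
  have pow: "transpose_mat (x k) = transpose_mat v * ?X ^\<^sub>m k" for k
  proof (induction k)
    case (Suc k)
    have "transpose_mat (x (Suc k)) = transpose_mat v * ?X ^\<^sub>m k * ?X" unfolding xS Suc ..
    also have "\<dots> = transpose_mat v * (?X ^\<^sub>m k * ?X)"
      using v Xc by (intro assoc_mult_mat[of _ 1 N _ N _ N]) auto
    finally show ?case by simp
  qed (use v Xc assms(9) in simp)
  have xM: "x (Suc k) $$ (j, 0) = (\<Sum>i < N. x k $$ (i, 0) * M i j)" if j: "j < N" for k j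
    using row_mult_index_sum[OF xc Xc j, of k] xc[of "Suc k"] j unfolding xS[symmetric] by (simp add: M_def)
  note perron = left_perron_vector_stochastic_iff[OF P N]
  have fixM: "(\<Sum>i < N. c $$ (i, 0) * M i j) = c $$ (j, 0)"
    if "left_perron_vector P c" "j < N" for c j
    using that resolvent_fixed_row_sum[OF P l] perron unfolding M_def by blast
  have conv: "mat_tendsto x c" if c: "left_perron_vector P c" for c
  proof -
    have "(\<Sum>i < N. x 0 $$ (i, 0)) = (\<Sum>i < N. c $$ (i, 0))"
      using c perron v assms(9) by simp
    then have "(\<lambda>k. x k $$ (j, 0)) \<longlonglongrightarrow> c $$ (j, 0)" if "j < N" for j
      using that
      by (intro iterates_tendsto_fixed_row[where X = M and N = N and u = "\<lambda>k i. x k $$ (i, 0)"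
            and c = "\<lambda>i. c $$ (i, 0)"] Mpos Msum xM fixM[OF c])
    then show ?thesis using c xc perron by (auto simp: mat_tendsto_def)
  qed
  have uniq: "b = c" if b: "left_perron_vector P b" and c: "left_perron_vector P c" for b c
  proof (rule eq_matI)
    fix i j assume "i < dim_row c" "j < dim_col c"
    then have ij: "i < N" "j = 0" using c perron by auto
    have "(\<Sum>i < N. b $$ (i, 0)) = (\<Sum>i < N. c $$ (i, 0))" using b c perron by simp
    then have "b $$ (i, 0) = c $$ (i, 0)"
      using ij(1)
      by (intro fixed_row_eq[where X = M and N = N and b = "\<lambda>i. b $$ (i, 0)"
            and c = "\<lambda>i. c $$ (i, 0)"] Mpos Msum fixM[OF b] fixM[OF c])
    then show "b $$ (i, j) = c $$ (i, j)" using ij by simp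
  qed (use b c perron in auto)
  have "\<exists>!c. left_perron_vector P c"
    using left_perron_vector_exists[OF P N l] Mpos[unfolded M_def] uniq by blast
  then show ?thesis using inv pow conv by blast
qed

end
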